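(* As formal power series in $x$, $$c_1^4e^{\alpha x}+c_2^4e^{\beta x}+c_3^4e^{\gamma x}=\frac{1}{484}\sum_{n=0}^\infty T_n^{(2,14,21)}\frac{x^n}{n!}.$$
   Context: Let $\alpha,\beta,\gamma$ be the three distinct complex roots of $x^3-x^2-x-1=0$, and set $c_1=\frac{\alpha}{(\alpha-\beta)(\alpha-\gamma)}$, $c_2=\frac{\beta}{(\beta-\alpha)(\beta-\gamma)}$, $c_3=\frac{\gamma}{(\gamma-\alpha)(\gamma-\beta)}$. For numbers $s_0,s_1,s_2$, the sequence $T_n^{(s_0,s_1,s_2)}$ is defined by $T_0^{(s_0,s_1,s_2)}=s_0$, $T_1^{(s_0,s_1,s_2)}=s_1$, $T_2^{(s_0,s_1,s_2)}=s_2$ and $T_n^{(s_0,s_1,s_2)}=T_{n-1}^{(s_0,s_1,s_2)}+T_{n-2}^{(s_0,s_1,s_2)}+T_{n-3}^{(s_0,s_1,s_2)}$ for $n\ge3$. *)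

theory Defs
  imports Complex_Main "HOL-Computational_Algebra.Formal_Power_Series"
begin

fun trib :: "'a::comm_ring_1 \<Rightarrow> 'a \<Rightarrow> 'a \<Rightarrow> nat \<Rightarrow> 'a" where
  "trib s0 s1 s2 0 = s0"
| "trib s0 s1 s2 (Suc 0) = s1"
| "trib s0 s1 s2 (Suc (Suc 0)) = s2"
| "trib s0 s1 s2 (Suc (Suc (Suc n))) =
     trib s0 s1 s2 (Suc (Suc n)) + trib s0 s1 s2 (Suc n) + trib s0 s1 s2 n"

end

theory Submission
  imports Defs
begin

text \<open>
  Write \<open>f(x) = x\<^sup>3 - x\<^sup>2 - x - 1\<close>. The weight attached to a root \<open>r\<close> of \<open>f\<close> is \<open>r / f'(r)\<close>, and
  reducing modulo \<open>f\<close> gives \<open>(r / f'(r))\<^sup>4 = (4 r\<^sup>2 + r - 3) / 968\<close>. Hence the coefficients of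
  \<open>x\<^sup>n / n!\<close> on the left are, up to the factor \<open>1 / 968\<close>, the sums of \<open>(4 r\<^sup>2 + r - 3) r\<^sup>n\<close> over the
  roots. They satisfy the Tribonacci recurrence, and their first three values are read off from
  the power sums \<open>3, 1, 3, 7, 11\<close> of the roots.
\<close>

text \<open>Divided differences: distinctness cancels \<open>a - b\<close> and \<open>a - c\<close>
  from the differences of the cubic equations. The two quotients differ by a multiple of
  \<open>b - c\<close>, whose cofactor gives the sum of the roots; putting
  \<open>c = 1 - a - b\<close> into a quotient gives the second identity.\<close>

lemma tribonacci_roots_vieta:
  fixes a b c :: "'a::field_char_0"
  assumes "a ^ 3 - a ^ 2 - a - 1 = 0" "b ^ 3 - b ^ 2 - b - 1 = 0" "c ^ 3 - c ^ 2 - c - 1 = 0"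
    and "a \<noteq> b" "a \<noteq> c" "b \<noteq> c"
  shows "a + b + c = 1" and "a * b + a * c + b * c = -1"
proof -
  have "(a - b) * (a ^ 2 + a * b + b ^ 2 - a - b - 1) = 0"
    using assms(1,2) by algebra
  then have ab: "a ^ 2 + a * b + b ^ 2 - a - b - 1 = 0"
    using assms(4) by simp
  have "(a - c) * (a ^ 2 + a * c + c ^ 2 - a - c - 1) = 0"
    using assms(1,3) by algebra
  then have ac: "a ^ 2 + a * c + c ^ 2 - a - c - 1 = 0"
    using assms(5) by simp
  have "(b - c) * (a + b + c - 1) = 0"
    using ab ac by algebra
  then show sum: "a + b + c = 1"
    using assms(6) by simp
  show "a * b + a * c + b * c = -1"
    using ab sum by algebra
qed

lemma tribonacci_weight_power4:
  fixes a b c :: "'a::field_char_0"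
  assumes root: "a ^ 3 - a ^ 2 - a - 1 = 0"
    and e1: "a + b + c = 1" and e2: "a * b + a * c + b * c = -1"
    and ne: "a \<noteq> b" "a \<noteq> c"
  shows "(a / ((a - b) * (a - c))) ^ 4 = (4 * a ^ 2 + a - 3) / 968"
proof -
  \<comment> \<open>\<open>w / 22\<close> is the quotient of \<open>a\<close> by the derivative of
    the cubic at \<open>a\<close>, written as a polynomial in \<open>a\<close> of degree 2.\<close>
  define w where "w = 5 * a ^ 2 - 3 * a - 4"
  \<comment> \<open>Both sides are the derivative of the cubic at its root \<open>a\<close>.\<close>
  have d: "(a - b) * (a - c) = 3 * a ^ 2 - 2 * a - 1"
    using e1 e2 by algebra
  have "a * 22 = w * ((a - b) * (a - c))"
    unfolding d w_def using root by algebra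
  then have quot: "a / ((a - b) * (a - c)) = w / 22"
    using ne by (subst frac_eq_eq) auto
  \<comment> \<open>Squaring twice, with reduction modulo the cubic each time, keeps the degree at
    2. The final denominator arises from \<open>22 ^ 4 = 242 * 968\<close>.\<close>
  have "w ^ 2 = 11 * (1 + 4 * a - a ^ 2)"
    unfolding w_def using root by algebra
  then have "w ^ 4 = 242 * (4 * a ^ 2 + a - 3)"
    using root by algebra
  then show ?thesis
    unfolding quot by (simp add: power_divide)
qed

lemma trib_eqI:
  assumes "f 0 = s0" "f 1 = s1" "f 2 = s2"
    and "\<And>n. f (n + 3) = f (n + 2) + f (n + 1) + f n"
  shows "trib s0 s1 s2 n = f n"
  using assms(1-3) assms(4)
  by (induction s0 s1 s2 n rule: trib.induct) (simp_all add: numeral_2_eq_2 numeral_3_eq_3)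

theorem lemma8:
  fixes \<alpha> \<beta> \<gamma> c\<^sub>1 c\<^sub>2 c\<^sub>3 :: complex
  assumes "\<alpha> ^ 3 - \<alpha> ^ 2 - \<alpha> - 1 = 0"
    and "\<beta> ^ 3 - \<beta> ^ 2 - \<beta> - 1 = 0"
    and "\<gamma> ^ 3 - \<gamma> ^ 2 - \<gamma> - 1 = 0"
    and "\<alpha> \<noteq> \<beta>" and "\<alpha> \<noteq> \<gamma>" and "\<beta> \<noteq> \<gamma>"
    and "c\<^sub>1 = \<alpha> / ((\<alpha> - \<beta>) * (\<alpha> - \<gamma>))"
    and "c\<^sub>2 = \<beta> / ((\<beta> - \<alpha>) * (\<beta> - \<gamma>))"
    and "c\<^sub>3 = \<gamma> / ((\<gamma> - \<alpha>) * (\<gamma> - \<beta>))"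
  shows "fps_const (c\<^sub>1 ^ 4) * fps_exp \<alpha> + fps_const (c\<^sub>2 ^ 4) * fps_exp \<beta>
           + fps_const (c\<^sub>3 ^ 4) * fps_exp \<gamma>
         = fps_const (1 / 484) * Abs_fps (\<lambda>n. trib 2 14 21 n / fact n)"
proof -
  note roots = assms(1-3)
  note vieta = tribonacci_roots_vieta [OF assms(1-6)]
  have c1: "c\<^sub>1 ^ 4 = (4 * \<alpha> ^ 2 + \<alpha> - 3) / 968"
    unfolding assms(7) using vieta assms by (intro tribonacci_weight_power4) auto
  have c2: "c\<^sub>2 ^ 4 = (4 * \<beta> ^ 2 + \<beta> - 3) / 968"
    unfolding assms(8) using vieta assms by (intro tribonacci_weight_power4) (auto simp: algebra_simps)
  have c3: "c\<^sub>3 ^ 4 = (4 * \<gamma> ^ 2 + \<gamma> - 3) / 968"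
    unfolding assms(9) using vieta assms by (intro tribonacci_weight_power4) (auto simp: algebra_simps)
  \<comment> \<open>Square of the sum minus twice the sum of products: 1 + 2 = 3.\<close>
  have p2: "\<alpha> ^ 2 + \<beta> ^ 2 + \<gamma> ^ 2 = 3"
    using vieta by algebra
  \<comment> \<open>Adding the three cubic equations gives 3 + 1 + 3 = 7; multiplying each by its
    root first gives 7 + 3 + 1 = 11 for the fourth powers.\<close>
  have p3: "\<alpha> ^ 3 + \<beta> ^ 3 + \<gamma> ^ 3 = 7"
    using roots vieta(1) p2 by algebra
  have p4: "\<alpha> ^ 4 + \<beta> ^ 4 + \<gamma> ^ 4 = 11"
    using roots vieta(1) p2 p3 by algebra
  have trib: "trib 2 14 21 n = 484 * (c\<^sub>1 ^ 4 * \<alpha> ^ n + c\<^sub>2 ^ 4 * \<beta> ^ n + c\<^sub>3 ^ 4 * \<gamma> ^ n)" for n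
  proof (rule trib_eqI)
    \<comment> \<open>Since 484 / 968 = 1 / 2, the three sums over the roots must be twice the
      initial values: 4, 28 and 42.\<close>
    have "(4 * \<alpha> ^ 2 + \<alpha> - 3) + (4 * \<beta> ^ 2 + \<beta> - 3) + (4 * \<gamma> ^ 2 + \<gamma> - 3)
        = 4 * (\<alpha> ^ 2 + \<beta> ^ 2 + \<gamma> ^ 2) + (\<alpha> + \<beta> + \<gamma>) - 9"
      by (simp add: algebra_simps)
    also have "\<dots> = 4"
      unfolding p2 vieta(1) by simp
    finally show "484 * (c\<^sub>1 ^ 4 * \<alpha> ^ 0 + c\<^sub>2 ^ 4 * \<beta> ^ 0 + c\<^sub>3 ^ 4 * \<gamma> ^ 0) = 2"
      unfolding c1 c2 c3 by (simp add: add_divide_distrib [symmetric])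
    have "(4 * \<alpha> ^ 2 + \<alpha> - 3) * \<alpha> + (4 * \<beta> ^ 2 + \<beta> - 3) * \<beta> + (4 * \<gamma> ^ 2 + \<gamma> - 3) * \<gamma> = 28"
      using vieta(1) p2 p3 by algebra
    then show "484 * (c\<^sub>1 ^ 4 * \<alpha> ^ 1 + c\<^sub>2 ^ 4 * \<beta> ^ 1 + c\<^sub>3 ^ 4 * \<gamma> ^ 1) = 14"
      unfolding c1 c2 c3 by (simp add: add_divide_distrib [symmetric])
    have "(4 * \<alpha> ^ 2 + \<alpha> - 3) * \<alpha> ^ 2 + (4 * \<beta> ^ 2 + \<beta> - 3) * \<beta> ^ 2
        + (4 * \<gamma> ^ 2 + \<gamma> - 3) * \<gamma> ^ 2
        = 4 * (\<alpha> ^ 4 + \<beta> ^ 4 + \<gamma> ^ 4) + (\<alpha> ^ 3 + \<beta> ^ 3 + \<gamma> ^ 3)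
          - 3 * (\<alpha> ^ 2 + \<beta> ^ 2 + \<gamma> ^ 2)"
      by algebra
    also have "\<dots> = 42"
      unfolding p2 p3 p4 by simp
    finally show "484 * (c\<^sub>1 ^ 4 * \<alpha> ^ 2 + c\<^sub>2 ^ 4 * \<beta> ^ 2 + c\<^sub>3 ^ 4 * \<gamma> ^ 2) = 21"
      unfolding c1 c2 c3 by (simp add: add_divide_distrib [symmetric])
    \<comment> \<open>The powers of each root satisfy the recurrence, hence so does every linear
      combination with constant weights.\<close>
    have "x ^ (n + 3) = x ^ (n + 2) + x ^ (n + 1) + x ^ n"
      if "x ^ 3 - x ^ 2 - x - 1 = 0" for x :: complex and n
    proof -
      have "x ^ 3 = x ^ 2 + x + 1"
        using that by algebra
      then show ?thesis
        by (simp add: power_add power2_eq_square algebra_simps)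
    qed
    from this [OF roots(1)] this [OF roots(2)] this [OF roots(3)]
    show "484 * (c\<^sub>1 ^ 4 * \<alpha> ^ (n + 3) + c\<^sub>2 ^ 4 * \<beta> ^ (n + 3) + c\<^sub>3 ^ 4 * \<gamma> ^ (n + 3)) =
        484 * (c\<^sub>1 ^ 4 * \<alpha> ^ (n + 2) + c\<^sub>2 ^ 4 * \<beta> ^ (n + 2) + c\<^sub>3 ^ 4 * \<gamma> ^ (n + 2)) +
        484 * (c\<^sub>1 ^ 4 * \<alpha> ^ (n + 1) + c\<^sub>2 ^ 4 * \<beta> ^ (n + 1) + c\<^sub>3 ^ 4 * \<gamma> ^ (n + 1)) +
        484 * (c\<^sub>1 ^ 4 * \<alpha> ^ n + c\<^sub>2 ^ 4 * \<beta> ^ n + c\<^sub>3 ^ 4 * \<gamma> ^ n)" for n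
      by (simp only: distrib_left add_ac)
  qed
  show ?thesis
    \<comment> \<open>Coefficientwise, the exponential series at a root \<open>r\<close> contributes
      \<open>r ^ n / fact n\<close>.\<close>
    by (rule fps_ext) (simp add: trib add_divide_distrib)
qed

end
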